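(* Let $X$ be a Banach space, let $M\subset X$ be a nonempty, closed and bounded set with $\|u\|\ge 1$ for every $u\in M$ and such that $\operatorname{cone}(M)$ is convex, and let $f\colon X\to\mathbb{R}$ be a function. Then the problem of minimizing $f$ over $X$ is Tykhonov well-posed with respect to $M$ if and only if there exist $\bar x\in X$ and an admissible function $c\colon D\to[0,\infty)$, whose domain $D$ contains $T_M(x,\bar x)$ for all $x\in D_{\bar x}$, such that $$f(\bar x)+c(T_M(x,\bar x))\le f(x)\quad\text{for all }x\in D_{\bar x}.$$
   Context: $\operatorname{cone}(M)=\{\lambda u\mid \lambda\ge 0,\ u\in M\}$. The minimal time function with respect to $M$ is $T_M(y,x):=\inf\{t\ge 0\mid x\in y+tM\}\in[0,\infty]$ for $y,x\in X$, with $\inf\emptyset=\infty$. For $x\in X$, $D_x:=\{z\in X\mid T_M(z,x)<\infty\}$. A point $\bar x$ is a global minimum point of $f$ with respect to $M$ on $D_{\bar x}$ if $f(\bar x)\le f(x)$ for all $x\in D_{\bar x}$; it is the unique such point on $D_{\bar x}$ if moreover $f(\bar x)<f(x)$ for all $x\in D_{\bar x}\setminus\{\bar x\}$. The problem of minimizing $f$ over $X$ is Tykhonov well-posed with respect to $M$ if there exists $\bar x\in X$ such that (i) $\bar x$ is the unique global minimum point of $f$ with respect to $M$ on $D_{\bar x}$, and (ii) for every sequence $(x_k)\subset D_{\bar x}$ with $f(x_k)\to f(\bar x)$, one has $T_M(x_k,\bar x)\to 0$ as $k\to\infty$. Admissible function: for a set $D\subset[0,\infty)$ with $0\in D$, a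 function $c\colon D\to[0,\infty)$ is admissible if (i) $c(0)=0$ and (ii) for every sequence $(t_k)\subset D$ with $c(t_k)\to 0$, one has $t_k\to 0$. *)

theory Defs
  imports "HOL-Analysis.Analysis"
begin

text \<open>
  Time to reach \<open>x\<close> from \<open>y\<close>. The values lie in \<open>[0, \<infinity>]\<close>, represented by \<^typ>\<open>ennreal\<close>,
  in which \<open>Inf {} = \<infinity>\<close>.
\<close>

definition minimal_time :: "'a::real_vector set \<Rightarrow> 'a \<Rightarrow> 'a \<Rightarrow> ennreal" where
  "minimal_time M y x = Inf {ennreal t |t. 0 \<le> t \<and> x \<in> (\<lambda>u. y + t *\<^sub>R u) ` M}"

definition time_domain :: "'a::real_vector set \<Rightarrow> 'a \<Rightarrow> 'a set" where
  "time_domain M x = {z. minimal_time M z x < \<infinity>}"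

definition unique_global_min_wrt :: "'a::real_vector set \<Rightarrow> ('a \<Rightarrow> real) \<Rightarrow> 'a \<Rightarrow> bool" where
  "unique_global_min_wrt M f xbar \<longleftrightarrow>
     (\<forall>x\<in>time_domain M xbar. f xbar \<le> f x) \<and>
     (\<forall>x\<in>time_domain M xbar - {xbar}. f xbar < f x)"

definition tykhonov_well_posed_wrt :: "'a::real_vector set \<Rightarrow> ('a \<Rightarrow> real) \<Rightarrow> bool" where
  "tykhonov_well_posed_wrt M f \<longleftrightarrow>
     (\<exists>xbar. unique_global_min_wrt M f xbar \<and>
        (\<forall>x :: nat \<Rightarrow> 'a.
           (\<forall>k. x k \<in> time_domain M xbar) \<and> (\<lambda>k. f (x k)) \<longlonglongrightarrow> f xbar
             \<longrightarrow> (\<lambda>k. minimal_time M (x k) xbar) \<longlonglongrightarrow> 0))"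

text \<open>
  A function \<open>c : D \<rightarrow> [0, \<infinity>)\<close> is a total function of which only the values on \<open>D\<close> matter.
\<close>

definition admissible_on :: "real set \<Rightarrow> (real \<Rightarrow> real) \<Rightarrow> bool" where
  "admissible_on D c \<longleftrightarrow>
     D \<subseteq> {0..} \<and> 0 \<in> D \<and> c \<in> D \<rightarrow> {0..} \<and> c 0 = 0 \<and>
     (\<forall>t :: nat \<Rightarrow> real.
        (\<forall>k. t k \<in> D) \<and> (\<lambda>k. c (t k)) \<longlonglongrightarrow> 0 \<longrightarrow> t \<longlonglongrightarrow> 0)"

end

theory Submission
  imports Defs
begin

text \<open>
  Boundedness of \<open>M\<close> makes the minimal time to \<open>xbar\<close> vanish only at \<open>xbar\<close>. Given
  well-posedness, the infimum of \<open>f - f xbar\<close> over each level set of the minimal time is therefore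
  an admissible function. Conversely, an admissible \<open>c\<close> satisfies
  \<open>0 \<le> c (T x) \<le> f x - f xbar\<close> for the minimal time \<open>T\<close>, so minimizing sequences have
  \<open>c (T x) \<longlonglongrightarrow> 0\<close>; applied to constant sequences, this gives uniqueness of the minimizer.
\<close>

lemma minimal_time_self:
  assumes "M \<noteq> {}"
  shows "minimal_time M x x = 0"
proof -
  have "x \<in> (\<lambda>u. x + 0 *\<^sub>R u) ` M"
    using assms by auto
  then have "minimal_time M x x \<le> ennreal 0"
    unfolding minimal_time_def by (intro Inf_lower) blast
  then show ?thesis by simp
qed

text \<open>If \<open>B\<close> bounds the norms in \<open>M\<close>, then
  \<open>x = y + t *\<^sub>R u\<close> with \<open>u \<in> M\<close> gives
  \<open>norm (x - y) \<le> t * B\<close>. An infimum 0 provides such \<open>t\<close> below every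
  \<open>e / B\<close>, whether or not it is attained.\<close>

lemma minimal_time_eq_0_imp_eq:
  fixes x y :: "'a::real_normed_vector"
  assumes "bounded M" and "minimal_time M y x = 0"
  shows "y = x"
proof -
  obtain B where "0 < B" and B: "\<And>u. u \<in> M \<Longrightarrow> norm u \<le> B"
    using assms(1) by (auto simp: bounded_pos)
  have "norm (x - y) \<le> 0 + e" if "0 < e" for e
  proof -
    have "Inf {ennreal t |t. 0 \<le> t \<and> x \<in> (\<lambda>u. y + t *\<^sub>R u) ` M} < ennreal (e / B)"
      using assms(2) \<open>0 < B\<close> \<open>0 < e\<close> by (simp add: minimal_time_def)
    then obtain t u where t: "0 \<le> t" "ennreal t < ennreal (e / B)"
      and u: "u \<in> M" "x = y + t *\<^sub>R u"
      unfolding Inf_less_iff by blast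
    have "t < e / B"
      using t by (simp add: ennreal_less_iff)
    then have "t * norm u \<le> e / B * B"
      using t B[OF u(1)] by (intro mult_mono) auto
    then show ?thesis
      using u t \<open>0 < B\<close> by simp
  qed
  then have "norm (x - y) \<le> 0"
    by (rule field_le_epsilon)
  then show ?thesis by simp
qed

lemma mem_time_domain_self:
  assumes "M \<noteq> {}"
  shows "x \<in> time_domain M x"
  using minimal_time_self[OF assms] by (simp add: time_domain_def)

text \<open>Bridge between the real times on which \<open>c\<close> acts and the extended times in
  well-posedness.\<close>

lemma ennreal_enn2real_minimal_time:
  assumes "x \<in> time_domain M y"
  shows "ennreal (enn2real (minimal_time M x y)) = minimal_time M x y"
  using assms by (simp add: time_domain_def)

lemma well_posed_imp_admissible_minorant:
  fixes M :: "'a::real_normed_vector set" and f :: "'a \<Rightarrow> real"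
  assumes "M \<noteq> {}" and "bounded M" and "tykhonov_well_posed_wrt M f"
  shows "\<exists>xbar D c. admissible_on D c \<and>
       (\<forall>x\<in>time_domain M xbar. enn2real (minimal_time M x xbar) \<in> D) \<and>
       (\<forall>x\<in>time_domain M xbar. f xbar + c (enn2real (minimal_time M x xbar)) \<le> f x)"
proof -
  obtain xbar where le: "\<And>x. x \<in> time_domain M xbar \<Longrightarrow> f xbar \<le> f x"
    and conv: "\<And>x :: nat \<Rightarrow> 'a. \<lbrakk>\<And>k. x k \<in> time_domain M xbar; (\<lambda>k. f (x k)) \<longlonglongrightarrow> f xbar\<rbrakk>
      \<Longrightarrow> (\<lambda>k. minimal_time M (x k) xbar) \<longlonglongrightarrow> 0"
    using assms(3) unfolding tykhonov_well_posed_wrt_def unique_global_min_wrt_def by blast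
  define T where "T x = enn2real (minimal_time M x xbar)" for x
  \<comment> \<open>\<open>enn2real\<close> sends \<infinity> to 0, so without the restriction to
    the time domain, points that cannot reach \<open>xbar\<close> would fall into level 0.\<close>
  define L where "L t = {x \<in> time_domain M xbar. T x = t}" for t
  define D where "D = T ` time_domain M xbar"
  \<comment> \<open>On \<open>D\<close> this is the largest function of the time alone that
    satisfies the required inequality.\<close>
  define c where "c t = (INF x\<in>L t. f x - f xbar)" for t
  have self: "xbar \<in> time_domain M xbar" and T0: "T xbar = 0"
    using mem_time_domain_self[OF assms(1)] minimal_time_self[OF assms(1), of xbar]
    by (simp_all add: T_def)
  have L0: "L 0 = {xbar}"
  proof -
    have "x = xbar" if "x \<in> L 0" for x
    proof -
      have "minimal_time M x xbar = 0"
        using that ennreal_enn2real_minimal_time[of x M xbar] by (simp add: L_def T_def)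
      then show ?thesis
        by (rule minimal_time_eq_0_imp_eq[OF assms(2)])
    qed
    then show ?thesis
      using self T0 by (auto simp: L_def)
  qed
  have bdd: "bdd_below ((\<lambda>x. f x - f xbar) ` L t)" for t
    using le by (intro bdd_belowI2[where m = 0]) (auto simp: L_def)
  have nonempty: "L t \<noteq> {}" if "t \<in> D" for t
    using that by (auto simp: L_def D_def)
  have c_nonneg: "0 \<le> c t" if "t \<in> D" for t
    unfolding c_def using le nonempty[OF that] by (intro cINF_greatest) (auto simp: L_def)
  have "t \<longlonglongrightarrow> 0" if tD: "\<And>k. t k \<in> D" and ct: "(\<lambda>k. c (t k)) \<longlonglongrightarrow> 0" for t :: "nat \<Rightarrow> real"
  proof -
    \<comment> \<open>The infimum over a level need not be attained. A slack of
      \<open>1 / (k + 1)\<close> yields a point with time exactly \<open>t k\<close>, and it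
      vanishes in the limit, so the chosen points form a minimizing sequence.\<close>
    have "\<exists>x\<in>L (t k). f x - f xbar < c (t k) + inverse (real (Suc k))" for k
      using cINF_less_iff[OF nonempty[OF tD[of k]] bdd, of "c (t k) + inverse (real (Suc k))"]
      by (simp add: c_def del: of_nat_Suc)
    then obtain x where x: "\<And>k. x k \<in> L (t k)"
      and less: "\<And>k. f (x k) - f xbar < c (t k) + inverse (real (Suc k))"
      by metis
    have dom: "x k \<in> time_domain M xbar" and Tx: "T (x k) = t k" for k
      using x[of k] by (auto simp: L_def)
    have "(\<lambda>k. c (t k) + inverse (real (Suc k))) \<longlonglongrightarrow> 0"
      using tendsto_add[OF ct LIMSEQ_inverse_real_of_nat] by simp
    then have "(\<lambda>k. f (x k) - f xbar) \<longlonglongrightarrow> 0"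
      by (rule tendsto_sandwich[OF always_eventually always_eventually tendsto_const, rotated 2])
        (simp add: le[OF dom], simp add: less_imp_le[OF less] del: of_nat_Suc)
    then have "(\<lambda>k. minimal_time M (x k) xbar) \<longlonglongrightarrow> 0"
      using conv dom by (simp add: LIM_zero_iff)
    then have "(\<lambda>k. T (x k)) \<longlonglongrightarrow> 0"
      unfolding T_def by (rule tendsto_enn2real[of _ 0, simplified])
    then show ?thesis
      by (simp add: Tx)
  qed
  moreover have "0 \<in> D"
    unfolding D_def using self T0 by (metis image_eqI)
  moreover have "c 0 = 0"
    by (simp add: c_def L0)
  moreover have "D \<subseteq> {0..}"
    by (auto simp: D_def T_def)
  ultimately have "admissible_on D c"
    using c_nonneg by (auto simp: admissible_on_def)
  moreover have "f xbar + c (T x) \<le> f x" if "x \<in> time_domain M xbar" for x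
    using cINF_lower[OF bdd, of x "T x"] that by (simp add: c_def L_def)
  ultimately show ?thesis
    unfolding T_def D_def by blast
qed

lemma admissible_minorant_imp_well_posed:
  fixes M :: "'a::real_normed_vector set" and f :: "'a \<Rightarrow> real"
  assumes "bounded M" and adm: "admissible_on D c"
    and D: "\<And>x. x \<in> time_domain M xbar \<Longrightarrow> enn2real (minimal_time M x xbar) \<in> D"
    and minorant: "\<And>x. x \<in> time_domain M xbar \<Longrightarrow>
      f xbar + c (enn2real (minimal_time M x xbar)) \<le> f x"
  shows "tykhonov_well_posed_wrt M f"
proof -
  define T where "T x = enn2real (minimal_time M x xbar)" for x
  have c_nonneg: "0 \<le> c (T x)" if "x \<in> time_domain M xbar" for x
    using adm D[OF that] unfolding admissible_on_def T_def by auto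
  have c_le: "c (T x) \<le> f x - f xbar" if "x \<in> time_domain M xbar" for x
    using minorant[OF that] by (simp add: T_def)
  \<comment> \<open>Convergence is established before strict minimality, which is deduced from
    it.\<close>
  have conv: "(\<lambda>k. minimal_time M (x k) xbar) \<longlonglongrightarrow> 0"
    if dom: "\<And>k. x k \<in> time_domain M xbar" and lim: "(\<lambda>k. f (x k)) \<longlonglongrightarrow> f xbar" for x :: "nat \<Rightarrow> 'a"
  proof -
    have "(\<lambda>k. f (x k) - f xbar) \<longlonglongrightarrow> 0"
      using lim by (simp add: LIM_zero)
    then have "(\<lambda>k. c (T (x k))) \<longlonglongrightarrow> 0"
      by (rule tendsto_sandwich[OF always_eventually always_eventually tendsto_const, rotated 2])
        (simp_all add: c_nonneg[OF dom] c_le[OF dom])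
    \<comment> \<open>Admissibility applies to the times \<open>T (x k)\<close>, all of which lie in
      \<open>D\<close>.\<close>
    then have "(\<lambda>k. T (x k)) \<longlonglongrightarrow> 0"
      using adm D[OF dom, folded T_def] by (simp add: admissible_on_def)
    then have "(\<lambda>k. ennreal (T (x k))) \<longlonglongrightarrow> 0"
      by (rule tendsto_ennrealI[of _ 0, simplified])
    then show ?thesis
      by (simp add: T_def ennreal_enn2real_minimal_time[OF dom])
  qed
  have le: "f xbar \<le> f x" if "x \<in> time_domain M xbar" for x
    using c_nonneg[OF that] c_le[OF that] by simp
  have "f xbar < f x" if dom: "x \<in> time_domain M xbar" and "x \<noteq> xbar" for x
  proof (rule ccontr)
    assume "\<not> f xbar < f x"
    then have "f x = f xbar"
      using le[OF dom] by simp
    \<comment> \<open>A tie makes the sequence constantly equal to \<open>x\<close> minimizing, so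
      its constant time must equal the limit 0.\<close>
    then have "(\<lambda>k::nat. minimal_time M x xbar) \<longlonglongrightarrow> 0"
      using conv[of "\<lambda>_. x"] dom by simp
    then have "minimal_time M x xbar = 0"
      by (simp add: LIMSEQ_const_iff)
    then show False
      using minimal_time_eq_0_imp_eq[OF assms(1)] \<open>x \<noteq> xbar\<close> by blast
  qed
  then show ?thesis
    unfolding tykhonov_well_posed_wrt_def unique_global_min_wrt_def using le conv by blast
qed

theorem theorem4p2:
  fixes M :: "'a::banach set" and f :: "'a \<Rightarrow> real"
  assumes "M \<noteq> {}" and "closed M" and "bounded M"
    and "\<forall>u\<in>M. 1 \<le> norm u"
    and "convex (cone hull M)"
  shows "tykhonov_well_posed_wrt M f \<longleftrightarrow>
    (\<exists>xbar D c. admissible_on D c \<and>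
       (\<forall>x\<in>time_domain M xbar. enn2real (minimal_time M x xbar) \<in> D) \<and>
       (\<forall>x\<in>time_domain M xbar.
          f xbar + c (enn2real (minimal_time M x xbar)) \<le> f x))"
  using well_posed_imp_admissible_minorant[OF assms(1,3)]
    admissible_minorant_imp_well_posed[OF assms(3)]
  by blast

end
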